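(* Let $n \ge 24$ be an integer. Then there exists a hypergraph $\mathcal{H}=(V,\mathcal{E})$ with $EI(\mathcal{H}) = C_n$ such that the following holds. (i) If $n$ is even, then $\mathcal{H}$ is 3-regular, 6-uniform and $|\mathcal{E}| = \frac{n}{2}$. (ii) If $n$ is odd, then $\mathcal{H}$ is 3-regular, $|\mathcal{E}| = \frac{n+1}{2}$, $\mathcal{H}$ contains one hyperedge of cardinality 3 and all other hyperedges in $\mathcal{H}$ have cardinality 6.
   Context: A hypergraph $\mathcal{H}=(V,\mathcal{E})$ consists of a finite vertex set $V$ and a set $\mathcal{E}$ of hyperedges, which are subsets of $V$; isolated vertices are allowed, but there are no multiple hyperedges and no loops (hyperedges with only one vertex). $\mathcal{H}$ is $k$-uniform if every hyperedge has cardinality $k$. The degree of a vertex $v$ is the number of hyperedges containing $v$, and $\mathcal{H}$ is $r$-regular if every vertex has degree $r$. The edge intersection hypergraph of $\mathcal{H}$ is $EI(\mathcal{H})=(V,\mathcal{E}^{EI})$, with the same vertex set $V$ and edge set $\mathcal{E}^{EI}=\{e_1\cap e_2 \mid e_1,e_2\in\mathcal{E},\ e_1\neq e_2,\ |e_1\cap e_2|\ge 2\}$. $C_n$ denotes the cycle with $n$ vertices, i.e. the graph with vertex set $V=\{1,2,\ldots,n\}$ and edge set $\{\{1,2\},\{2,3\},\ldots,\{n-1,n\},\{n,1\}\}$, regarded as a 2-uniform hypergraph. The equality $EI(\mathcal{H})=C_n$ means that $V=\{1,\ldots,n\}$ (up to labelling of the vertices) and $\mathcal{E}^{EI}=E(C_n)$.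 *)

theory Defs
  imports Main
begin

type_synonym 'a hypergraph = "'a set \<times> 'a set set"

abbreviation vertices :: "'a hypergraph \<Rightarrow> 'a set" where
  "vertices H \<equiv> fst H"

abbreviation hyperedges :: "'a hypergraph \<Rightarrow> 'a set set" where
  "hyperedges H \<equiv> snd H"

text \<open>Hyperedges form a set, so there are no multiple hyperedges; the last conjunct excludes loops.\<close>

definition is_hypergraph :: "'a hypergraph \<Rightarrow> bool" where
  "is_hypergraph H \<longleftrightarrow>
     finite (vertices H) \<and>
     (\<forall>e \<in> hyperedges H. e \<subseteq> vertices H) \<and>
     (\<forall>e \<in> hyperedges H. card e \<noteq> 1)"

definition uniform :: "nat \<Rightarrow> 'a hypergraph \<Rightarrow> bool" where
  "uniform k H \<longleftrightarrow> (\<forall>e \<in> hyperedges H. card e = k)"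

definition vertex_degree :: "'a hypergraph \<Rightarrow> 'a \<Rightarrow> nat" where
  "vertex_degree H v = card {e \<in> hyperedges H. v \<in> e}"

definition regular :: "nat \<Rightarrow> 'a hypergraph \<Rightarrow> bool" where
  "regular r H \<longleftrightarrow> (\<forall>v \<in> vertices H. vertex_degree H v = r)"

definition EI :: "'a hypergraph \<Rightarrow> 'a hypergraph" where
  "EI H = (vertices H,
     {e1 \<inter> e2 | e1 e2. e1 \<in> hyperedges H \<and> e2 \<in> hyperedges H \<and> e1 \<noteq> e2 \<and> card (e1 \<inter> e2) \<ge> 2})"

definition cycle_graph :: "nat \<Rightarrow> nat hypergraph" where
  "cycle_graph n = ({1..n}, {{i, i + 1} | i. 1 \<le> i \<and> i < n} \<union> {{n, 1}})"

end

theory Submission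
  imports Defs
begin

text \<open>
  Every cycle edge must be an intersection of two hyperedges. At a vertex \<open>v\<close> of degree 3 only three
  hyperedges are available for the two cycle edges at \<open>v\<close>, so one of them contains both, that is,
  \<open>v - 1\<close>, \<open>v\<close> and \<open>v + 1\<close>, the arc around \<open>v\<close>. This suggests hyperedges that are unions of arcs: a
  6-element hyperedge is the union of two disjoint arcs, a 3-element hyperedge is a single arc.
  Such a hypergraph is an involution \<open>p\<close> of the cycle that pairs the centres of the two arcs
  of a hyperedge, a fixed point of \<open>p\<close> giving the 3-element hyperedge.

  Two arcs with adjacent centres meet in the cycle edge between the centres; arcs with centres at
  distance 2 meet in one vertex; arcs with centres further apart are disjoint. Hence everything
  works as soon as two distinct hyperedges have at most one intersecting pair of arcs. For this it
  suffices that partners are at distance at least 5, and that the partners of two distinct vertices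
  at distance at most 2 are at distance at least 3. The locale \<open>cyclic_pairing\<close>
  collects these conditions. Every vertex then lies on three arcs, belonging to three
  different hyperedges, and counting incidences gives the number of hyperedges.

  It remains to find such involutions for every large \<open>n\<close>. If the involution also sends the two
  vertices at each end of \<open>1, \<dots>, n\<close> inwards, without the two ends interfering with each other
  (\<open>extendable_pairing\<close>), then two involutions can be put side by side: vertices
  near a seam have their partners well inside their own parts, so no new conflict arises. Explicit
  involutions on 20, \<dots>, 39 vertices, lengthened by copies of the one on 20 vertices, thus cover all
  \<open>n \<ge> 20\<close>.
\<close>

section \<open>Arcs on the cycle\<close>

text \<open>On \<open>{1..n}\<close> this says that the distance of \<open>u\<close> and \<open>v\<close> around the cycle is at least \<open>d\<close>.
  Written without subtraction it stays within linear arithmetic on the naturals.\<close>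

definition far :: "nat \<Rightarrow> nat \<Rightarrow> nat \<Rightarrow> nat \<Rightarrow> bool" where
  "far n d u v \<longleftrightarrow> u + d \<le> v \<and> v + d \<le> u + n \<or> v + d \<le> u \<and> u + d \<le> v + n"

definition arc :: "nat \<Rightarrow> nat \<Rightarrow> nat set" where
  "arc n v = {if v = 1 then n else v - 1, v, if v = n then 1 else v + 1}"

lemma far_commute: "far n d u v \<longleftrightarrow> far n d v u"
  by (auto simp: far_def)

lemma far_irrefl: "0 < d \<Longrightarrow> \<not> far n d v v"
  by (auto simp: far_def)

lemma far_antimono: "far n d u v \<Longrightarrow> d' \<le> d \<Longrightarrow> far n d' u v"
  by (auto simp: far_def)

text \<open>The triangle inequality \<open>dist u v \<le> dist u w + dist w v\<close>: if the conclusion fails, the right-hand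
  side is at most \<open>(d - 1) + (e - 1) < c\<close>.\<close>

lemma far_triangle:
  assumes "far n c u v" "d + e \<le> c + 1" "u \<in> {1..n}" "v \<in> {1..n}" "w \<in> {1..n}"
  shows "far n d u w \<or> far n e w v"
  using assms unfolding far_def atLeastAtMost_iff by linarith

lemma mem_arc_iff:
  assumes "3 \<le> n" "v \<in> {1..n}"
  shows "x \<in> arc n v \<longleftrightarrow> x \<in> {1..n} \<and> \<not> far n 2 x v"
  using assms by (auto simp: arc_def far_def)

lemma self_in_arc: "v \<in> arc n v"
  by (simp add: arc_def)

lemma card_arc:
  assumes "3 \<le> n" "v \<in> {1..n}"
  shows "card (arc n v) = 3"
  using assms by (auto simp: arc_def card_insert_if)

lemma finite_arc: "finite (arc n v)"
  by (simp add: arc_def)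

lemma arc_disjoint_if_far:
  assumes "3 \<le> n" "u \<in> {1..n}" "v \<in> {1..n}" "far n 3 u v"
  shows "arc n u \<inter> arc n v = {}"
proof (rule equals0I)
  fix x assume "x \<in> arc n u \<inter> arc n v"
  then have x: "x \<in> {1..n}" "\<not> far n 2 u x" "\<not> far n 2 x v"
    using assms mem_arc_iff far_commute by blast+
  then show False
    using far_triangle[of n 3 u v 2 2 x] assms by simp
qed

lemma arcs_of_neighbours:
  assumes "5 \<le> n" "u \<in> {1..n}" "v \<in> {1..n}" "u \<noteq> v" "\<not> far n 2 u v"
  shows "arc n u \<inter> arc n v = {u, v}"
  using assms unfolding arc_def far_def atLeastAtMost_iff by (auto split: if_splits)

text \<open>If \<open>u\<close> and \<open>v\<close> have cyclic distance 2, the arcs share only the vertex between them. It is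
  unique because a second common neighbour would close a 4-cycle, and \<open>n > 4\<close>.\<close>

lemma card_arc_Int_if_far:
  assumes "5 \<le> n" "u \<in> {1..n}" "v \<in> {1..n}" "far n 2 u v"
  shows "card (arc n u \<inter> arc n v) \<le> 1"
proof -
  have "x = y" if "x \<in> arc n u \<inter> arc n v" "y \<in> arc n u \<inter> arc n v" for x y
  proof -
    have "x \<in> {1..n}" "y \<in> {1..n}" "\<not> far n 2 x u" "\<not> far n 2 x v" "\<not> far n 2 y u" "\<not> far n 2 y v"
      using that assms mem_arc_iff[of n u] mem_arc_iff[of n v] by auto
    then show ?thesis
      using assms unfolding far_def atLeastAtMost_iff by linarith
  qed
  then show ?thesis
    by (metis card_le_Suc0_iff_eq finite_Int finite_arc One_nat_def)
qed

lemma cycle_graph_edges: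
  assumes "3 \<le> n"
  shows "hyperedges (cycle_graph n) =
    {{u, v} | u v. u \<in> {1..n} \<and> v \<in> {1..n} \<and> u \<noteq> v \<and> \<not> far n 2 u v}" (is "?C = ?N")
proof
  show "?C \<subseteq> ?N"
  proof
    fix e assume "e \<in> ?C"
    then consider i where "e = {i, i + 1}" "1 \<le> i" "i < n" | "e = {n, 1}"
      by (auto simp: cycle_graph_def)
    then show "e \<in> ?N"
    proof cases
      case 1
      then have "i \<in> {1..n}" "i + 1 \<in> {1..n}" "i \<noteq> i + 1" "\<not> far n 2 i (i + 1)"
        using assms by (auto simp: far_def)
      with 1 show ?thesis by blast
    next
      case 2
      have "n \<in> {1..n}" "1 \<in> {1..n}" "n \<noteq> 1" "\<not> far n 2 n 1"
        using assms by (auto simp: far_def)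
      with 2 show ?thesis by blast
    qed
  qed
  show "?N \<subseteq> ?C"
  proof
    fix e assume "e \<in> ?N"
    then obtain u v where e: "e = {u, v}" and uv: "u \<in> {1..n}" "v \<in> {1..n}" "u \<noteq> v" "\<not> far n 2 u v"
      by blast
    then consider "v = u + 1" | "u = v + 1" | "u = n" "v = 1" | "u = 1" "v = n"
      unfolding far_def atLeastAtMost_iff by linarith
    then show "e \<in> ?C"
      using e uv by cases (auto simp: cycle_graph_def insert_commute)
  qed
qed

section \<open>Hypergraphs from pairings of arcs\<close>

text \<open>The condition \<open>fixed_iff\<close> puts the single vertex without a partner, needed for odd \<open>n\<close>, always at 3.
  A uniform place keeps it out of the way when pairings are joined; 1 and 2 are excluded because the
  vertices at the ends have to be sent inwards.\<close>

locale cyclic_pairing =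
  fixes n :: nat and p :: "nat \<Rightarrow> nat"
  assumes n_ge: "5 \<le> n"
    and partner_mem: "v \<in> {1..n} \<Longrightarrow> p v \<in> {1..n}"
    and partner_partner: "v \<in> {1..n} \<Longrightarrow> p (p v) = v"
    and fixed_iff: "v \<in> {1..n} \<Longrightarrow> p v = v \<longleftrightarrow> odd n \<and> v = 3"
    and partner_far: "v \<in> {1..n} \<Longrightarrow> p v \<noteq> v \<Longrightarrow> far n 5 v (p v)"
    and near_partners_far:
      "\<lbrakk>u \<in> {1..n}; v \<in> {1..n}; u \<noteq> v; \<not> far n 3 u v\<rbrakk> \<Longrightarrow> far n 3 (p u) (p v)"
begin

definition block :: "nat \<Rightarrow> nat set" where
  "block v = arc n v \<union> arc n (p v)"

definition block_hypergraph :: "nat hypergraph" where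
  "block_hypergraph = ({1..n}, block ` {1..n})"

lemma n_ge_3: "3 \<le> n"
  using n_ge by simp

lemma block_partner: "v \<in> {1..n} \<Longrightarrow> block (p v) = block v"
  by (auto simp: block_def partner_partner)

lemma arc_disjoint_partner:
  "v \<in> {1..n} \<Longrightarrow> p v \<noteq> v \<Longrightarrow> arc n v \<inter> arc n (p v) = {}"
  using arc_disjoint_if_far[OF n_ge_3] partner_far far_antimono[of n 5 v "p v" 3] partner_mem by simp

lemma card_block: "v \<in> {1..n} \<Longrightarrow> card (block v) = (if p v = v then 3 else 6)"
  using card_Un_disjoint[OF finite_arc finite_arc arc_disjoint_partner[of v]]
    card_arc[OF n_ge_3, of v] card_arc[OF n_ge_3, of "p v"] partner_mem[of v]
  by (auto simp: block_def)

lemma block_subset: "v \<in> {1..n} \<Longrightarrow> block v \<subseteq> {1..n}"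
  using mem_arc_iff[OF n_ge_3] partner_mem unfolding block_def by blast

text \<open>An arc cannot meet both arcs of a hyperedge: its centre would be within distance 2 of two
  partners, which are at least 5 apart.\<close>

lemma disjoint_arc_partner:
  assumes "a \<in> {1..n}" "c \<in> {1..n}" "p c \<noteq> c" "arc n a \<inter> arc n c \<noteq> {}"
  shows "arc n a \<inter> arc n (p c) = {}"
proof -
  have "\<not> far n 3 a c"
    using assms arc_disjoint_if_far[OF n_ge_3] by blast
  then have "far n 3 a (p c)"
    using far_triangle[of n 5 c "p c" 3 3 a] partner_far assms partner_mem far_commute by fastforce
  then show ?thesis
    using assms arc_disjoint_if_far[OF n_ge_3] partner_mem by blast
qed

text \<open>Of the four intersections of an arc of \<open>block a\<close> with an arc of \<open>block c\<close>, one being nonempty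
  rules out the opposite one by \<open>near_partners_far\<close> and the two mixed ones by the previous lemma.
  At a fixed point the two arcs of the block coincide, so that a mixed intersection may be nonempty
  but adds nothing.\<close>

lemma block_Int_of_meeting_arcs:
  assumes "a \<in> {1..n}" "c \<in> {1..n}" "c \<noteq> a" "arc n a \<inter> arc n c \<noteq> {}"
  shows "block a \<inter> block c = arc n a \<inter> arc n c"
proof -
  have "arc n (p a) \<inter> arc n (p c) = {}"
  proof -
    have "\<not> far n 3 a c"
      using assms arc_disjoint_if_far[OF n_ge_3] by blast
    then show ?thesis
      using assms near_partners_far arc_disjoint_if_far[OF n_ge_3] partner_mem by metis
  qed
  moreover have "arc n a \<inter> arc n (p c) \<subseteq> arc n c"
    using disjoint_arc_partner[of a c] assms by (cases "p c = c") auto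
  moreover have "arc n (p a) \<inter> arc n c \<subseteq> arc n a"
    using disjoint_arc_partner[of c a] assms by (cases "p a = a") auto
  ultimately show ?thesis
    unfolding block_def by blast
qed

text \<open>Some arc of \<open>block a\<close> meets some arc of \<open>block c\<close>. Partners have the same block, so the
  centres of these two arcs may take the place of \<open>a\<close> and \<open>c\<close>.\<close>

lemma block_Int_is_arc_Int:
  assumes "a \<in> {1..n}" "c \<in> {1..n}" "c \<noteq> a" "c \<noteq> p a" "block a \<inter> block c \<noteq> {}"
  obtains x y where "x \<in> {1..n}" "y \<in> {1..n}" "x \<noteq> y" "block a \<inter> block c = arc n x \<inter> arc n y"
proof -
  obtain x y where xy: "x \<in> {a, p a}" "y \<in> {c, p c}" "arc n x \<inter> arc n y \<noteq> {}"
    using assms(5) unfolding block_def by blast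
  have mem: "x \<in> {1..n}" "y \<in> {1..n}"
    using xy assms partner_mem by auto
  have ne: "y \<noteq> x"
    using xy assms partner_partner[of a] partner_partner[of c] by auto
  have "block x = block a" "block y = block c"
    using xy assms block_partner by auto
  then have "block a \<inter> block c = arc n x \<inter> arc n y"
    using block_Int_of_meeting_arcs[OF mem ne xy(3)] by simp
  with mem ne that show thesis by blast
qed

lemma card_arc_Int_le:
  assumes "x \<in> {1..n}" "y \<in> {1..n}" "x \<noteq> y"
  shows "card (arc n x \<inter> arc n y) \<le> 2"
  using card_arc_Int_if_far[OF n_ge assms(1,2)] arcs_of_neighbours[OF n_ge assms] assms(3)
  by (cases "far n 2 x y") auto

text \<open>Blocks of vertices that are neither equal nor partners share at most two vertices, fewer than
  a block has.\<close>

lemma block_eq_iff: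
  assumes "a \<in> {1..n}" "c \<in> {1..n}"
  shows "block a = block c \<longleftrightarrow> c = a \<or> c = p a"
proof
  assume eq: "block a = block c"
  show "c = a \<or> c = p a"
  proof (rule ccontr)
    assume *: "\<not> (c = a \<or> c = p a)"
    have "block a \<inter> block c \<noteq> {}"
      using eq self_in_arc unfolding block_def by blast
    then obtain x y where "x \<in> {1..n}" "y \<in> {1..n}" "x \<noteq> y" "block a \<inter> block c = arc n x \<inter> arc n y"
      using block_Int_is_arc_Int[OF assms] * by metis
    then have "card (block a) \<le> 2"
      using card_arc_Int_le eq by auto
    then show False
      using card_block[OF assms(1)] by (simp split: if_splits)
  qed
qed (use block_partner assms in auto)

text \<open>An intersection of two blocks is one of two arcs, and two arcs share two vertices only if
  their centres are adjacent. Conversely, adjacent vertices are too close to be partners, so their arcs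
  belong to different blocks, which then meet in the edge between them.\<close>

lemma EI_block_hypergraph: "EI block_hypergraph = cycle_graph n"
proof -
  have "hyperedges (EI block_hypergraph) = hyperedges (cycle_graph n)"
  proof
    show "hyperedges (EI block_hypergraph) \<subseteq> hyperedges (cycle_graph n)"
    proof
      fix e assume "e \<in> hyperedges (EI block_hypergraph)"
      then have "\<exists>e1 \<in> block ` {1..n}. \<exists>e2 \<in> block ` {1..n}. e1 \<noteq> e2 \<and> e = e1 \<inter> e2 \<and> 2 \<le> card e"
        unfolding EI_def block_hypergraph_def by fastforce
      then obtain a c where ac: "a \<in> {1..n}" "c \<in> {1..n}" "block a \<noteq> block c"
        and e: "e = block a \<inter> block c" "2 \<le> card e"
        by blast
      have "block a \<inter> block c \<noteq> {}"
        using e by auto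
      then obtain x y where xy: "x \<in> {1..n}" "y \<in> {1..n}" "x \<noteq> y" "e = arc n x \<inter> arc n y"
        using block_Int_is_arc_Int[OF ac(1,2)] ac block_eq_iff[OF ac(1,2)] e(1) by metis
      then have near: "\<not> far n 2 x y"
        using card_arc_Int_if_far[OF n_ge] e(2) by fastforce
      then have "e = {x, y}"
        using arcs_of_neighbours[OF n_ge] xy by simp
      then show "e \<in> hyperedges (cycle_graph n)"
        using cycle_graph_edges[OF n_ge_3] xy near by blast
    qed
    show "hyperedges (cycle_graph n) \<subseteq> hyperedges (EI block_hypergraph)"
    proof
      fix e assume "e \<in> hyperedges (cycle_graph n)"
      then obtain u v where e: "e = {u, v}"
        and uv: "u \<in> {1..n}" "v \<in> {1..n}" "u \<noteq> v" "\<not> far n 2 u v"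
        using cycle_graph_edges[OF n_ge_3] by auto
      have arcs: "arc n u \<inter> arc n v = {u, v}"
        using arcs_of_neighbours[OF n_ge] uv by blast
      then have e_eq: "e = block u \<inter> block v"
        using block_Int_of_meeting_arcs[OF uv(1,2)] uv(3) e by auto
      have "v \<noteq> p u"
        using partner_far[OF uv(1)] uv far_antimono[of n 5 u v 2] by auto
      then have "block u \<noteq> block v"
        using block_eq_iff[OF uv(1,2)] uv(3) by auto
      moreover have "2 \<le> card (block u \<inter> block v)"
        using e e_eq uv(3) by auto
      ultimately show "e \<in> hyperedges (EI block_hypergraph)"
        using e_eq uv(1,2) unfolding EI_def block_hypergraph_def fst_conv snd_conv by blast
    qed
  qed
  then show ?thesis
    by (intro prod_eqI) (auto simp: EI_def block_hypergraph_def cycle_graph_def)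
qed

lemma is_hypergraph_block_hypergraph: "is_hypergraph block_hypergraph"
  using block_subset card_block by (auto simp: is_hypergraph_def block_hypergraph_def)

text \<open>The vertex \<open>v\<close> lies on the arc around \<open>a\<close> exactly if \<open>a\<close> lies on the arc around \<open>v\<close>, so the
  hyperedges through \<open>v\<close> are the blocks of the three vertices on its arc. These blocks are
  distinct because partners are too far apart to lie on a common arc.\<close>

lemma regular_block_hypergraph: "regular 3 block_hypergraph"
proof -
  have "vertex_degree block_hypergraph v = 3" if v: "v \<in> {1..n}" for v
  proof -
    have arc_sym: "v \<in> arc n a \<longleftrightarrow> a \<in> arc n v" if "a \<in> {1..n}" for a
      using mem_arc_iff[OF n_ge_3] that v far_commute by blast
    have arc_sub: "arc n v \<subseteq> {1..n}"
      using mem_arc_iff[OF n_ge_3 v] by blast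
    have "{e \<in> block ` {1..n}. v \<in> e} = block ` arc n v"
    proof (intro equalityI subsetI)
      fix e assume "e \<in> {e \<in> block ` {1..n}. v \<in> e}"
      then obtain a where a: "a \<in> {1..n}" "e = block a" "v \<in> block a" by blast
      then have "a \<in> arc n v \<or> p a \<in> arc n v"
        using arc_sym partner_mem unfolding block_def by blast
      then show "e \<in> block ` arc n v"
        using a block_partner by (metis imageI)
    next
      fix e assume "e \<in> block ` arc n v"
      then obtain a where "a \<in> arc n v" "e = block a" by blast
      then show "e \<in> {e \<in> block ` {1..n}. v \<in> e}"
        using arc_sub arc_sym unfolding block_def by blast
    qed
    moreover have "inj_on block (arc n v)"
    proof (rule inj_onI)
      fix a c assume ac: "a \<in> arc n v" "c \<in> arc n v" "block a = block c"
      then have mem: "a \<in> {1..n}" "c \<in> {1..n}" using arc_sub by auto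
      then have "arc n a \<inter> arc n c \<noteq> {}"
        using arc_sym ac by blast
      then show "a = c"
        using arc_disjoint_partner[OF mem(1)] block_eq_iff[OF mem] ac(3) by metis
    qed
    ultimately show ?thesis
      unfolding vertex_degree_def block_hypergraph_def
      by (simp add: card_image card_arc[OF n_ge_3 v])
  qed
  then show ?thesis
    by (simp add: regular_def block_hypergraph_def)
qed

text \<open>Counting incident pairs of a vertex and a hyperedge by vertices; the number of hyperedges
  follows since their sizes are known.\<close>

lemma sum_card_blocks: "(\<Sum>e\<in>block ` {1..n}. card e) = 3 * n"
proof -
  have "(\<Sum>e\<in>block ` {1..n}. card {v \<in> {1..n}. v \<in> e}) = 3 * card {1..n}"
    using regular_block_hypergraph
    by (intro sum_multicount) (auto simp: regular_def vertex_degree_def block_hypergraph_def)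
  moreover have "{v \<in> {1..n}. v \<in> e} = e" if "e \<in> block ` {1..n}" for e
    using that block_subset by blast
  ultimately show ?thesis
    by simp
qed

lemma uniform_and_card_if_even:
  assumes "even n"
  shows "uniform 6 block_hypergraph" "card (hyperedges block_hypergraph) = n div 2"
proof -
  have six: "card e = 6" if "e \<in> block ` {1..n}" for e
    using that card_block fixed_iff assms by fastforce
  then show "uniform 6 block_hypergraph"
    by (simp add: uniform_def block_hypergraph_def)
  have "6 * card (block ` {1..n}) = 3 * n"
    using sum_card_blocks six by simp
  then show "card (hyperedges block_hypergraph) = n div 2"
    by (simp add: block_hypergraph_def)
qed

lemma sizes_if_odd:
  assumes "odd n"
  shows "card (hyperedges block_hypergraph) = (n + 1) div 2"
    and "\<exists>e \<in> hyperedges block_hypergraph. card e = 3 \<and>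
      (\<forall>f \<in> hyperedges block_hypergraph - {e}. card f = 6)"
proof -
  let ?E = "block ` {1..n}"
  have mem: "3 \<in> {1..n}"
    using n_ge by auto
  then have three: "card (block 3) = 3"
    using card_block fixed_iff assms by simp
  have six: "card f = 6" if "f \<in> ?E - {block 3}" for f
    using that card_block fixed_iff assms by fastforce
  have in_E: "block 3 \<in> ?E"
    using mem by blast
  have "(\<Sum>e\<in>?E. card e) = 3 + 6 * card (?E - {block 3})"
    using sum.remove[OF _ in_E, of card] three six by simp
  moreover have "card ?E = card (?E - {block 3}) + 1"
    using card_Suc_Diff1[OF _ in_E] by simp
  ultimately have "2 * card ?E = n + 1"
    using sum_card_blocks by simp
  then show "card (hyperedges block_hypergraph) = (n + 1) div 2"
    by (simp add: block_hypergraph_def)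
  show "\<exists>e \<in> hyperedges block_hypergraph. card e = 3 \<and>
      (\<forall>f \<in> hyperedges block_hypergraph - {e}. card f = 6)"
    using three six unfolding block_hypergraph_def snd_conv by (intro bexI[OF _ in_E]) blast
qed

end

section \<open>Concatenating pairings\<close>

text \<open>The first two conditions make the partners point away from a seam when another pairing is
  attached there. The last one keeps the partners of the first two vertices and those of the last two
  apart; once something is inserted between \<open>n\<close> and \<open>1\<close> they only move further apart. Together
  with the second it keeps the partners of the first two vertices away from the last ones, and
  symmetrically, so that they cannot come close to a partner in the attached part at the other seam.\<close>

locale extendable_pairing = cyclic_pairing +
  assumes first_forward: "u \<in> {1, 2} \<Longrightarrow> u + 5 \<le> p u"
    and last_backward: "v \<in> {n - 1, n} \<Longrightarrow> p v + 5 \<le> v"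
    and ends_uncrossed: "u \<in> {1, 2} \<Longrightarrow> v \<in> {n - 1, n} \<Longrightarrow> p u + 3 \<le> p v"

definition concat_pairing :: "nat \<Rightarrow> (nat \<Rightarrow> nat) \<Rightarrow> (nat \<Rightarrow> nat) \<Rightarrow> nat \<Rightarrow> nat" where
  "concat_pairing m p q v = (if v \<le> m then p v else m + q (v - m))"

text \<open>An even length of the second part is what the position of the fixed point needs: no
  vertex of the second part is fixed, and the parity of the length stays that of the first part.\<close>

lemma extendable_concat_pairing:
  assumes "extendable_pairing m p" "extendable_pairing k q" "even k"
  shows "extendable_pairing (m + k) (concat_pairing m p q)"
proof -
  interpret P: extendable_pairing m p by fact
  interpret Q: extendable_pairing k q by fact
  let ?r = "concat_pairing m p q"
  \<comment> \<open>Vertices are addressed from here on by their part and their position in it.\<close>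
  have left: "?r u = p u" if "u \<in> {1..m}" for u
    using that by (simp add: concat_pairing_def)
  have right: "?r (m + v) = m + q v" if "v \<in> {1..k}" for v
    using that by (simp add: concat_pairing_def)
  have split: thesis
    if "u \<in> {1..m + k}" "u \<in> {1..m} \<Longrightarrow> thesis" "\<And>v. v \<in> {1..k} \<Longrightarrow> u = m + v \<Longrightarrow> thesis" for u thesis
    using that(1) that(2) that(3)[of "u - m"] by fastforce
  have p_mem: "1 \<le> p u \<and> p u \<le> m" if "u \<in> {1..m}" for u
    using P.partner_mem[OF that] by simp
  have q_mem: "1 \<le> q v \<and> q v \<le> k" if "v \<in> {1..k}" for v
    using Q.partner_mem[OF that] by simp
  have p_first: "6 \<le> p u \<and> p u + 8 \<le> m" if "u \<in> {1, 2}" for u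
    using P.first_forward[OF that] P.ends_uncrossed[OF that, of m] P.last_backward[of m] that by auto
  have p_last: "9 \<le> p v \<and> p v + 5 \<le> m" if "v \<in> {m - 1, m}" for v
    using P.last_backward[OF that] P.ends_uncrossed[of 1 v] P.first_forward[of 1] that by auto
  have q_first: "6 \<le> q u \<and> q u + 8 \<le> k" if "u \<in> {1, 2}" for u
    using Q.first_forward[OF that] Q.ends_uncrossed[OF that, of k] Q.last_backward[of k] that by auto
  have q_last: "9 \<le> q v \<and> q v + 5 \<le> k" if "v \<in> {k - 1, k}" for v
    using Q.last_backward[OF that] Q.ends_uncrossed[of 1 v] Q.first_forward[of 1] that by auto
  \<comment> \<open>Near vertices in different parts sit at a seam, and their partners point away from it.\<close>
  have mixed: "far (m + k) 3 (p u) (m + q v)"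
    if uv: "u \<in> {1..m}" "v \<in> {1..k}" "\<not> far (m + k) 3 u (m + v)" for u v
  proof -
    have "u + 3 > m + v \<or> m + v + 3 > u + (m + k)"
      using uv by (auto simp: far_def)
    then have "u \<in> {m - 1, m} \<and> v \<in> {1, 2} \<or> u \<in> {1, 2} \<and> v \<in> {k - 1, k}"
      using uv(1,2) by auto
    then show ?thesis
    proof
      assume "u \<in> {m - 1, m} \<and> v \<in> {1, 2}"
      then show ?thesis
        using p_last[of u] q_first[of v] unfolding far_def by linarith
    next
      assume "u \<in> {1, 2} \<and> v \<in> {k - 1, k}"
      then show ?thesis
        using p_first[of u] q_last[of v] unfolding far_def by linarith
    qed
  qed
  show ?thesis
  proof unfold_locales
    show "5 \<le> m + k" using P.n_ge by simp
  next
    fix v assume "v \<in> {1..m + k}"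
    then show "?r v \<in> {1..m + k}"
      by (rule split) (use p_mem q_mem left right in force)+
  next
    fix v assume "v \<in> {1..m + k}"
    then show "?r (?r v) = v"
      by (rule split) (use left right P.partner_mem P.partner_partner Q.partner_mem Q.partner_partner in force)+
  next
    fix v assume "v \<in> {1..m + k}"
    then show "?r v = v \<longleftrightarrow> odd (m + k) \<and> v = 3"
      by (rule split) (use left right P.fixed_iff Q.fixed_iff P.n_ge assms(3) in force)+
  next
    fix v assume v: "v \<in> {1..m + k}" "?r v \<noteq> v"
    show "far (m + k) 5 v (?r v)"
      using v(1)
    proof (rule split)
      assume "v \<in> {1..m}"
      then show ?thesis
        using v(2) left P.partner_far[of v] by (auto simp: far_def)
    next
      fix w assume "w \<in> {1..k}" "v = m + w"
      then show ?thesis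
        using v(2) right Q.partner_far[of w] by (auto simp: far_def)
    qed
  next
    fix u v assume uv: "u \<in> {1..m + k}" "v \<in> {1..m + k}" "u \<noteq> v" "\<not> far (m + k) 3 u v"
    show "far (m + k) 3 (?r u) (?r v)"
      using uv(1)
    proof (rule split)
      assume u: "u \<in> {1..m}"
      show ?thesis
        using uv(2)
      proof (rule split)
        assume v: "v \<in> {1..m}"
        have "\<not> far m 3 u v"
          using uv(4) by (auto simp: far_def)
        then show ?thesis
          using P.near_partners_far[OF u v uv(3)] left u v by (auto simp: far_def)
      next
        fix w assume "w \<in> {1..k}" "v = m + w"
        then show ?thesis
          using mixed[OF u, of w] uv(4) left u right by simp
      qed
    next
      fix x assume x: "x \<in> {1..k}" "u = m + x"
      show ?thesis
        using uv(2)
      proof (rule split)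
        assume "v \<in> {1..m}"
        then show ?thesis
          using mixed[of v x] uv(4) left right x far_commute by auto
      next
        fix w assume w: "w \<in> {1..k}" "v = m + w"
        have "\<not> far k 3 x w" "x \<noteq> w"
          using uv(3,4) x w by (auto simp: far_def)
        then show ?thesis
          using Q.near_partners_far[OF x(1) w(1)] right x w by (auto simp: far_def)
      qed
    qed
  next
    fix u :: nat assume "u \<in> {1, 2}"
    then show "u + 5 \<le> ?r u"
      using left[of u] P.first_forward[of u] P.n_ge by auto
  next
    fix v assume "v \<in> {m + k - 1, m + k}"
    then obtain w where "w \<in> {k - 1, k}" "w \<in> {1..k}" "v = m + w"
      using Q.n_ge by fastforce
    then show "?r v + 5 \<le> v"
      using right[of w] Q.last_backward[of w] by auto
  next
    fix u v :: nat assume u: "u \<in> {1, 2}" and "v \<in> {m + k - 1, m + k}"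
    then obtain w where "w \<in> {k - 1, k}" "w \<in> {1..k}" "v = m + w"
      using Q.n_ge by fastforce
    moreover have "?r u = p u"
      using left[of u] u P.n_ge by auto
    ultimately show "?r u + 3 \<le> ?r v"
      using right[of w] p_first[OF u] q_last[of w] by auto
  qed
qed

section \<open>Pairings on 20 to 39 vertices\<close>

text \<open>A table lists the partners of \<open>1, \<dots>, n\<close>, in list positions \<open>0, \<dots>, n - 1\<close>.\<close>

definition pairing_of :: "nat list \<Rightarrow> nat \<Rightarrow> nat" where
  "pairing_of t v = t ! (v - 1)"

text \<open>The conditions of \<open>extendable_pairing\<close> in a form that takes little evaluation. Comparing the
  table with its rotations by one and by two places checks the partners of all vertices at
  cyclic distance 1 or 2, including those across the seam between \<open>n\<close> and \<open>1\<close>.\<close>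

definition valid_table :: "nat list \<Rightarrow> bool" where
  "valid_table t \<longleftrightarrow> (let n = length t in
     5 \<le> n \<and>
     list_all2 (\<lambda>v w. 1 \<le> w \<and> w \<le> n \<and> t ! (w - 1) = v \<and>
       (if odd n \<and> v = 3 then w = v else far n 5 v w)) [1..<n + 1] t \<and>
     list_all2 (far n 3) t (rotate1 t) \<and>
     list_all2 (far n 3) t (rotate1 (rotate1 t)) \<and>
     6 \<le> t ! 0 \<and> 7 \<le> t ! 1 \<and> t ! (n - 2) + 6 \<le> n \<and> t ! (n - 1) + 5 \<le> n \<and>
     max (t ! 0) (t ! 1) + 3 \<le> min (t ! (n - 2)) (t ! (n - 1)))"

text \<open>Found by backtracking, with the fixed point of the odd lengths prescribed to be 3.\<close>

definition tables :: "nat list list" where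
  "tables = [
    [6, 9, 13, 17, 10, 1, 14, 18, 2, 5, 16, 19, 3, 7, 20, 11, 4, 8, 12, 15],
    [7, 10, 3, 14, 11, 18, 1, 15, 19, 2, 5, 17, 20, 4, 8, 21, 12, 6, 9, 13, 16],
    [6, 9, 12, 15, 18, 1, 13, 19, 2, 16, 20, 3, 7, 21, 4, 10, 22, 5, 8, 11, 14, 17],
    [6, 9, 3, 12, 15, 1, 18, 21, 2, 16, 19, 4, 23, 20, 5, 10, 22, 7, 11, 14, 8, 17, 13],
    [6, 9, 12, 15, 18, 1, 13, 21, 2, 17, 22, 3, 7, 20, 4, 23, 10, 5, 24, 14, 8, 11, 16, 19],
    [6, 9, 3, 12, 15, 1, 18, 14, 2, 22, 19, 4, 23, 8, 5, 21, 24, 7, 11, 25, 16, 10, 13, 17,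
      20],
    [6, 9, 12, 15, 18, 1, 13, 19, 2, 24, 21, 3, 7, 22, 4, 26, 23, 5, 8, 25, 11, 14, 17, 10,
      20, 16],
    [6, 9, 3, 12, 15, 1, 18, 21, 2, 16, 24, 4, 20, 25, 5, 10, 23, 7, 26, 13, 8, 27, 17, 11,
      14, 19, 22],
    [6, 9, 12, 15, 18, 1, 13, 17, 2, 21, 25, 3, 7, 22, 4, 26, 8, 5, 24, 27, 10, 14, 28, 19,
      11, 16, 20, 23],
    [6, 9, 3, 12, 15, 1, 18, 13, 2, 19, 22, 4, 8, 26, 5, 23, 27, 7, 10, 25, 28, 11, 16, 29,
      20, 14, 17, 21, 24],
    [6, 9, 12, 15, 18, 1, 13, 19, 2, 22, 25, 3, 7, 26, 4, 23, 28, 5, 8, 27, 30, 10, 16, 29,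
      11, 14, 20, 17, 24, 21],
    [6, 9, 3, 12, 15, 1, 18, 13, 2, 20, 23, 4, 8, 26, 5, 29, 24, 7, 27, 10, 31, 28, 11, 17,
      30, 14, 19, 22, 16, 25, 21],
    [6, 9, 12, 15, 18, 1, 13, 16, 2, 21, 24, 3, 7, 27, 4, 8, 30, 5, 25, 28, 10, 32, 29, 11,
      19, 31, 14, 20, 23, 17, 26, 22],
    [6, 9, 3, 12, 15, 1, 18, 13, 2, 16, 22, 4, 8, 25, 5, 10, 29, 7, 26, 30, 33, 11, 28, 31,
      14, 19, 32, 23, 17, 20, 24, 27, 21],
    [6, 9, 12, 15, 18, 1, 13, 16, 2, 19, 23, 3, 7, 26, 4, 8, 30, 5, 10, 27, 31, 34, 11, 29,
      32, 14, 20, 33, 24, 17, 21, 25, 28, 22],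
    [6, 9, 3, 12, 15, 1, 18, 13, 2, 16, 20, 4, 8, 24, 5, 10, 27, 7, 31, 11, 28, 32, 35, 14,
      30, 33, 17, 21, 34, 25, 19, 22, 26, 29, 23],
    [6, 9, 12, 15, 18, 1, 13, 16, 2, 19, 22, 3, 7, 25, 4, 8, 26, 5, 10, 29, 33, 11, 30, 34,
      14, 17, 32, 35, 20, 23, 36, 27, 21, 24, 28, 31],
    [6, 9, 3, 12, 15, 1, 18, 13, 2, 16, 19, 4, 8, 22, 5, 10, 26, 7, 11, 29, 33, 14, 30, 34,
      37, 17, 32, 35, 20, 23, 36, 27, 21, 24, 28, 31, 25],
    [6, 9, 12, 15, 18, 1, 13, 16, 2, 19, 22, 3, 7, 23, 4, 8, 27, 5, 10, 30, 34, 11, 14, 31,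
      35, 38, 17, 33, 36, 20, 24, 37, 28, 21, 25, 29, 32, 26],
    [6, 9, 3, 12, 15, 1, 18, 13, 2, 16, 19, 4, 8, 20, 5, 10, 24, 7, 11, 14, 28, 31, 35, 17,
      32, 36, 39, 21, 34, 37, 22, 25, 38, 29, 23, 26, 30, 33, 27]]"

lemma valid_tables: "list_all valid_table tables"
  by code_simp

lemma length_tables: "map length tables = [20..<40]"
  by code_simp

lemma extendable_pairing_of_table:
  assumes "valid_table t"
  shows "extendable_pairing (length t) (pairing_of t)"
proof -
  define n where "n = length t"
  have n: "5 \<le> n"
    and entries: "list_all2 (\<lambda>v w. 1 \<le> w \<and> w \<le> n \<and> t ! (w - 1) = v \<and>
       (if odd n \<and> v = 3 then w = v else far n 5 v w)) [1..<n + 1] t"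
    and rot1: "list_all2 (far n 3) t (rotate1 t)"
    and rot2: "list_all2 (far n 3) t (rotate1 (rotate1 t))"
    and ends: "6 \<le> t ! 0" "7 \<le> t ! 1" "t ! (n - 2) + 6 \<le> n" "t ! (n - 1) + 5 \<le> n"
      "max (t ! 0) (t ! 1) + 3 \<le> min (t ! (n - 2)) (t ! (n - 1))"
    using assms unfolding valid_table_def n_def Let_def by blast+
  let ?p = "pairing_of t"
  have entry: "1 \<le> ?p v \<and> ?p v \<le> n \<and> ?p (?p v) = v \<and>
      (if odd n \<and> v = 3 then ?p v = v else far n 5 v (?p v))" if "v \<in> {1..n}" for v
  proof -
    have i: "v - 1 < length [1..<n + 1]"
      using that by auto
    have v_eq: "[1..<n + 1] ! (v - 1) = v"
      using that by (subst nth_upt) auto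
    then show ?thesis
      using list_all2_nthD[OF entries i] unfolding pairing_of_def v_eq by blast
  qed
  have fixed: "?p v = v \<longleftrightarrow> odd n \<and> v = 3" if "v \<in> {1..n}" for v
    using entry[OF that] far_irrefl[of 5 n v] by (auto split: if_splits)
  have step1: "far n 3 (t ! i) (t ! (Suc i mod n))" if "i < n" for i
    using list_all2_nthD[OF rot1, of i] that by (simp add: nth_rotate1 n_def)
  have step2: "far n 3 (t ! i) (t ! (Suc (Suc i) mod n))" if "i < n" for i
  proof -
    have "t \<noteq> []"
      using n by (auto simp: n_def)
    then show ?thesis
      using list_all2_nthD[OF rot2, of i] that by (simp add: nth_rotate1 n_def mod_Suc_eq)
  qed
  \<comment> \<open>Two near vertices are one or two cyclic steps apart, in one direction or the other.\<close>
  have forward: "far n 3 (?p u) (?p v)"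
    if uv: "u \<in> {1..n}" "v \<in> {1..n}" and step: "v = u + 1 \<or> v = u + 2 \<or> u + 1 = v + n \<or> u + 2 = v + n" for u v
  proof -
    have "v - 1 = Suc (u - 1) mod n \<or> v - 1 = Suc (Suc (u - 1)) mod n"
    proof -
      consider "v = u + 1" | "v = u + 2" | "u = n" "v = 1" | "u = n" "v = 2" | "u = n - 1" "v = 1"
        using step uv by fastforce
      then show ?thesis
        using uv n by cases (auto simp: mod_Suc)
    qed
    then show ?thesis
      using step1[of "u - 1"] step2[of "u - 1"] uv unfolding pairing_of_def by auto
  qed
  have "extendable_pairing n ?p"
  proof unfold_locales
    fix u v assume uv: "u \<in> {1..n}" "v \<in> {1..n}" "u \<noteq> v" "\<not> far n 3 u v"
    then have "(v = u + 1 \<or> v = u + 2 \<or> u + 1 = v + n \<or> u + 2 = v + n) \<or>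
        (u = v + 1 \<or> u = v + 2 \<or> v + 1 = u + n \<or> v + 2 = u + n)"
      unfolding far_def atLeastAtMost_iff by linarith
    then show "far n 3 (?p u) (?p v)"
      using forward uv(1,2) far_commute by blast
  next
    fix u :: nat assume "u \<in> {1, 2}"
    then show "u + 5 \<le> ?p u"
      using ends by (auto simp: pairing_of_def)
  next
    fix v assume "v \<in> {n - 1, n}"
    then show "?p v + 5 \<le> v"
      using ends n by (auto simp: pairing_of_def numeral_2_eq_2)
  next
    fix u v :: nat assume "u \<in> {1, 2}" "v \<in> {n - 1, n}"
    then show "?p u + 3 \<le> ?p v"
      using ends n by (auto simp: pairing_of_def numeral_2_eq_2)
  next
    fix v assume v: "v \<in> {1..n}" "?p v \<noteq> v"
    then show "far n 5 v (?p v)"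
      using entry[OF v(1)] by (simp split: if_splits)
  qed (use n entry fixed in auto)
  then show ?thesis
    by (simp add: n_def)
qed

lemma ex_extendable_pairing:
  assumes "20 \<le> n"
  shows "\<exists>p. extendable_pairing n p"
  using assms
proof (induction n rule: less_induct)
  case (less n)
  have table: "\<exists>p. extendable_pairing m p" if "20 \<le> m" "m < 40" for m
  proof -
    have "length tables = 20"
      using arg_cong[OF length_tables, of length] by simp
    then have i: "m - 20 < length tables"
      using that by simp
    have "[20..<40] ! (m - 20) = m"
      using that by (subst nth_upt) auto
    then have "length (tables ! (m - 20)) = m"
      using nth_map[OF i, of length] length_tables by metis
    moreover have "valid_table (tables ! (m - 20))"
      using valid_tables i by (simp add: list_all_length)
    ultimately show ?thesis
      using extendable_pairing_of_table by metis
  qed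
  show ?case
  proof (cases "n < 40")
    case True
    with less.prems table show ?thesis by blast
  next
    case False
    then have "n - 20 < n" "20 \<le> n - 20"
      by simp_all
    then obtain p where "extendable_pairing (n - 20) p"
      using less.IH by blast
    moreover obtain q where "extendable_pairing 20 q"
      using table[of 20] by auto
    ultimately have "extendable_pairing (n - 20 + 20) (concat_pairing (n - 20) p q)"
      by (rule extendable_concat_pairing) simp
    then show ?thesis
      using False by auto
  qed
qed

theorem theorem2:
  fixes n :: nat
  assumes "n \<ge> 24"
  shows "\<exists>H :: nat hypergraph.
    is_hypergraph H \<and> EI H = cycle_graph n \<and>
    (even n \<longrightarrow>
       regular 3 H \<and> uniform 6 H \<and> card (hyperedges H) = n div 2) \<and>
    (odd n \<longrightarrow>
       regular 3 H \<and> card (hyperedges H) = (n + 1) div 2 \<and>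
       (\<exists>e \<in> hyperedges H. card e = 3 \<and> (\<forall>f \<in> hyperedges H - {e}. card f = 6)))"
proof -
  obtain p where "extendable_pairing n p"
    using ex_extendable_pairing[of n] assms by auto
  then interpret extendable_pairing n p .
  show ?thesis
    using is_hypergraph_block_hypergraph EI_block_hypergraph regular_block_hypergraph
      uniform_and_card_if_even sizes_if_odd by blast
qed

end
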